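(* There is a universal constant $C$ such that for every Boolean function $f:\{0,1\}^n\to\{0,1\}$, $\deg(f)\le C\,\widetilde{\deg}(f)^2$.
   Context: $\deg(f)$ is the degree of the unique multilinear real polynomial agreeing with $f$ on $\{0,1\}^n$. A real polynomial $q$ $\epsilon$-approximates $f$ if $q(x)\in[0,\epsilon]$ for all $x\in f^{-1}(0)$ and $q(x)\in[1-\epsilon,1]$ for all $x\in f^{-1}(1)$. $\widetilde{\deg}(f)$ is the minimum degree of a polynomial that $1/3$-approximates $f$. *)

theory Defs
  imports Complex_Main
begin

text \<open>Points of the Boolean cube {0,1}^n are represented as functions
  x :: nat => bool with x i = False for i >= n.  A Boolean function
  f : {0,1}^n -> {0,1} is f :: (nat => bool) => bool (only its values on
  the cube matter).\<close>

definition cube :: "nat \<Rightarrow> (nat \<Rightarrow> bool) set" where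
  "cube n = {x. \<forall>i. n \<le> i \<longrightarrow> \<not> x i}"

definition to_real :: "(nat \<Rightarrow> bool) \<Rightarrow> nat \<Rightarrow> real" where
  "to_real x = (\<lambda>i. if x i then 1 else 0)"

definition monomials_le :: "nat \<Rightarrow> nat \<Rightarrow> (nat \<Rightarrow> nat) set" where
  "monomials_le n d = {a. (\<forall>i. n \<le> i \<longrightarrow> a i = 0) \<and> sum a {..<n} \<le> d}"

definition poly_deg_le :: "nat \<Rightarrow> nat \<Rightarrow> ((nat \<Rightarrow> real) \<Rightarrow> real) \<Rightarrow> bool" where
  "poly_deg_le n d q \<longleftrightarrow>
     (\<exists>c :: (nat \<Rightarrow> nat) \<Rightarrow> real.
        q = (\<lambda>x. \<Sum>a\<in>monomials_le n d. c a * (\<Prod>i<n. x i ^ a i)))"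

text \<open>Degree of f: degree of the (unique) multilinear polynomial agreeing with f on the cube.\<close>
definition bdeg :: "nat \<Rightarrow> ((nat \<Rightarrow> bool) \<Rightarrow> bool) \<Rightarrow> nat" where
  "bdeg n f = (LEAST d. \<exists>c :: nat set \<Rightarrow> real.
      (\<forall>S. d < card S \<longrightarrow> c S = 0) \<and>
      (\<forall>x\<in>cube n. (\<Sum>S\<in>Pow {..<n}. c S * (\<Prod>i\<in>S. to_real x i)) = (if f x then 1 else 0)))"

definition eps_approx :: "nat \<Rightarrow> real \<Rightarrow> ((nat \<Rightarrow> real) \<Rightarrow> real) \<Rightarrow> ((nat \<Rightarrow> bool) \<Rightarrow> bool) \<Rightarrow> bool" where
  "eps_approx n eps q f \<longleftrightarrow>
     (\<forall>x\<in>cube n. (\<not> f x \<longrightarrow> 0 \<le> q (to_real x) \<and> q (to_real x) \<le> eps) \<and>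
                  (f x \<longrightarrow> 1 - eps \<le> q (to_real x) \<and> q (to_real x) \<le> 1))"

definition adeg :: "nat \<Rightarrow> ((nat \<Rightarrow> bool) \<Rightarrow> bool) \<Rightarrow> nat" where
  "adeg n f = (LEAST d. \<exists>q. poly_deg_le n d q \<and> eps_approx n (1/3) q f)"

end

theory Submission
  imports Defs
begin

text \<open>
  Points of a subcube are identified with subsets of \<open>S\<close>. Let \<open>A\<close> be the adjacency operator of the
  hypercube on \<open>Pow S\<close> and \<open>A\<^sub>f\<close> its restriction to the sensitive edges of \<open>f\<close>.

  Upper bound: let \<open>P\<close> be an approximating polynomial of degree \<open>d\<close>. In the Fourier basis \<open>A\<close> is
  diagonal with eigenvalue \<open>|S| - 2|U|\<close> at \<open>U\<close>, while multiplication by \<open>P\<close> changes the level \<open>|U|\<close>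
  by at most \<open>d\<close>. A Bernstein-type argument then bounds the norm of the commutator
  \<open>[A, P]\<close> by \<open>4d\<close>. Its entries are \<open>P(y) - P(x)\<close> on the edges \<open>xy\<close>, hence at least \<open>1/3\<close> on
  the sensitive edges leading from \<open>f = 0\<close> to \<open>f = 1\<close>, so the norm of \<open>A\<^sub>f\<close> is at most \<open>12d\<close>.

  Lower bound: if the coefficient of the monomial \<open>S\<close> in \<open>f\<close> is nonzero, then \<open>f\<close> xor parity is
  unbalanced on \<open>Pow S\<close>. Its majority class \<open>H\<close> carries an eigenvector, for the eigenvalue
  \<open>sqrt |S|\<close>, of Huang's signed hypercube matrix, and every hypercube edge inside \<open>H\<close> is
  sensitive for \<open>f\<close>. So the norm of \<open>A\<^sub>f\<close> is at least \<open>sqrt |S|\<close>, whence \<open>|S| \<le> 144 d\<^sup>2\<close>.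
\<close>

section \<open>Fourier analysis on the subsets of a finite set\<close>

definition flip :: "'a \<Rightarrow> 'a set \<Rightarrow> 'a set" where
  "flip i T = (if i \<in> T then T - {i} else insert i T)"

lemma flip_flip [simp]: "flip i (flip i T) = T"
  by (auto simp: flip_def)

lemma flip_commute: "flip i (flip j T) = flip j (flip i T)"
  by (auto simp: flip_def)

lemma flip_subset_iff: "i \<in> S \<Longrightarrow> flip i T \<subseteq> S \<longleftrightarrow> T \<subseteq> S"
  by (auto simp: flip_def)

lemma sum_flip:
  assumes "i \<in> S"
  shows "(\<Sum>T\<in>Pow S. h (flip i T)) = (\<Sum>T\<in>Pow S. h T)"
  by (rule sum.reindex_bij_witness[of _ "flip i" "flip i"]) (use assms in \<open>auto simp: flip_subset_iff\<close>)

lemma sum_flip_antisym: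
  fixes h :: "'a set \<Rightarrow> real"
  assumes "i \<in> S" "\<And>T. h (flip i T) = - h T"
  shows "(\<Sum>T\<in>Pow S. h T) = 0"
  using sum_flip[OF assms(1), of h] by (simp add: assms(2) sum_negf)

text \<open>The Walsh character of index \<open>U\<close>. By its symmetry in the two arguments the
  transform is its own inverse up to scaling.\<close>

definition chi :: "'a set \<Rightarrow> 'a set \<Rightarrow> real" where
  "chi U T = (-1) ^ card (U \<inter> T)"

lemma chi_commute: "chi U T = chi T U"
  by (simp add: chi_def Int_commute)

lemma chi_flip:
  assumes "finite U"
  shows "chi U (flip i T) = (if i \<in> U then -1 else 1) * chi U T"
proof -
  consider "i \<notin> U" | "i \<in> U" "i \<in> T" | "i \<in> U" "i \<notin> T" by blast
  then show ?thesis
  proof cases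
    case 1
    then have "U \<inter> flip i T = U \<inter> T" by (auto simp: flip_def)
    with 1 show ?thesis by (simp add: chi_def)
  next
    case 2
    then have "U \<inter> T = insert i (U \<inter> flip i T)" "i \<notin> U \<inter> flip i T"
      by (auto simp: flip_def)
    then have "card (U \<inter> T) = Suc (card (U \<inter> flip i T))"
      using assms by (metis card_insert_disjoint finite_Int)
    with 2 show ?thesis by (simp add: chi_def)
  next
    case 3
    then have "U \<inter> flip i T = insert i (U \<inter> T)" "i \<notin> U \<inter> T"
      by (auto simp: flip_def)
    then have "card (U \<inter> flip i T) = Suc (card (U \<inter> T))"
      using assms by (metis card_insert_disjoint finite_Int)
    with 3 show ?thesis by (simp add: chi_def)
  qed
qed

lemma chi_self_mult [simp]: "chi U T * chi U T = 1"
  by (simp add: chi_def flip: power_add)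

lemma chi_nonzero: "chi U T \<noteq> 0"
  by (simp add: chi_def)

text \<open>Flipping \<open>i\<close> negates exactly one of the two characters and fixes
  \<open>g\<close>, so the terms cancel in pairs. A constant \<open>g\<close> gives orthogonality; a
  monomial \<open>g\<close> gives the band structure of \<open>fourier_entry\<close>.\<close>

lemma sum_chi_chi_invariant_eq_0:
  assumes "finite S" "U \<subseteq> S" "V \<subseteq> S" "i \<in> S" "i \<in> U \<longleftrightarrow> i \<notin> V"
    and "\<And>T. g (flip i T) = g T"
  shows "(\<Sum>T\<in>Pow S. g T * chi U T * chi V T) = 0"
proof (rule sum_flip_antisym[OF assms(4)])
  fix T
  have "finite U" "finite V" using assms by (auto intro: finite_subset)
  then show "g (flip i T) * chi U (flip i T) * chi V (flip i T) = - (g T * chi U T * chi V T)"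
    using assms(5) by (auto simp: chi_flip assms(6))
qed

lemma chi_orthogonal:
  assumes "finite S" "U \<subseteq> S" "V \<subseteq> S"
  shows "(\<Sum>T\<in>Pow S. chi U T * chi V T) = (if U = V then 2 ^ card S else 0)"
proof (cases "U = V")
  case True
  with assms show ?thesis by (simp add: card_Pow)
next
  case False
  then obtain i where "i \<in> U \<longleftrightarrow> i \<notin> V" by blast
  moreover from this have "i \<in> S" using assms by auto
  ultimately show ?thesis
    using sum_chi_chi_invariant_eq_0[OF assms, of i "\<lambda>_. 1"] False by simp
qed

lemma parseval:
  assumes "finite S" "I \<subseteq> Pow S"
  shows "(\<Sum>T\<in>Pow S. (\<Sum>U\<in>I. a U * chi U T)\<^sup>2) = 2 ^ card S * (\<Sum>U\<in>I. (a U)\<^sup>2)"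
proof -
  have fin: "finite I" using assms finite_subset by auto
  have "(\<Sum>T\<in>Pow S. (\<Sum>U\<in>I. a U * chi U T)\<^sup>2)
      = (\<Sum>T\<in>Pow S. \<Sum>U\<in>I. \<Sum>V\<in>I. a U * a V * (chi U T * chi V T))"
    by (simp add: power2_eq_square sum_product mult_ac)
  also have "\<dots> = (\<Sum>U\<in>I. \<Sum>T\<in>Pow S. \<Sum>V\<in>I. a U * a V * (chi U T * chi V T))"
    by (rule sum.swap)
  also have "\<dots> = (\<Sum>U\<in>I. \<Sum>V\<in>I. \<Sum>T\<in>Pow S. a U * a V * (chi U T * chi V T))"
    by (intro sum.cong refl sum.swap)
  also have "\<dots> = (\<Sum>U\<in>I. \<Sum>V\<in>I. if U = V then a U * a V * 2 ^ card S else 0)"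
    using assms by (intro sum.cong refl) (subst sum_distrib_left[symmetric], subst chi_orthogonal, auto)
  also have "\<dots> = 2 ^ card S * (\<Sum>U\<in>I. (a U)\<^sup>2)"
    using fin by (simp add: sum.delta power2_eq_square sum_distrib_left mult_ac)
  finally show ?thesis .
qed

lemma fourier_inversion:
  assumes "finite S" "T \<subseteq> S"
  shows "(\<Sum>U\<in>Pow S. (\<Sum>W\<in>Pow S. u W * chi W U) * chi U T) = 2 ^ card S * u T"
proof -
  have "(\<Sum>U\<in>Pow S. (\<Sum>W\<in>Pow S. u W * chi W U) * chi U T)
      = (\<Sum>U\<in>Pow S. \<Sum>W\<in>Pow S. u W * (chi W U * chi T U))"
    by (simp only: sum_distrib_right mult.assoc chi_commute[of _ T])
  also have "\<dots> = (\<Sum>W\<in>Pow S. \<Sum>U\<in>Pow S. u W * (chi W U * chi T U))"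
    by (rule sum.swap)
  also have "\<dots> = (\<Sum>W\<in>Pow S. if W = T then u W * 2 ^ card S else 0)"
    using assms by (intro sum.cong refl) (subst sum_distrib_left[symmetric], subst chi_orthogonal, auto)
  also have "\<dots> = 2 ^ card S * u T"
    using assms by (simp add: sum.delta)
  finally show ?thesis .
qed

text \<open>The matrix of multiplication by \<open>P\<close> in the character basis, scaled by
  \<open>2 ^ card S\<close> because the characters are not normalized.\<close>

definition fourier_entry :: "'a set \<Rightarrow> ('a set \<Rightarrow> real) \<Rightarrow> 'a set \<Rightarrow> 'a set \<Rightarrow> real" where
  "fourier_entry S P U V = (\<Sum>T\<in>Pow S. P T * chi U T * chi V T)"

lemma fourier_entry_commute: "fourier_entry S P U V = fourier_entry S P V U"
  by (simp add: fourier_entry_def mult_ac)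

text \<open>Multiplication by a function bounded by 1 is a contraction. The bound is a mean of
  squared norms instead of a product of norms, so that it can be summed over blocks.\<close>

lemma fourier_block_bound:
  assumes "finite S" "I \<subseteq> Pow S" "J \<subseteq> Pow S" and P: "\<And>T. T \<subseteq> S \<Longrightarrow> \<bar>P T\<bar> \<le> 1"
  shows "\<bar>\<Sum>U\<in>I. \<Sum>V\<in>J. a U * b V * fourier_entry S P U V\<bar>
       \<le> 2 ^ card S * ((\<Sum>U\<in>I. (a U)\<^sup>2) + (\<Sum>V\<in>J. (b V)\<^sup>2)) / 2"
proof -
  let ?f = "\<lambda>T. \<Sum>U\<in>I. a U * chi U T" and ?g = "\<lambda>T. \<Sum>V\<in>J. b V * chi V T"
  have "(\<Sum>U\<in>I. \<Sum>V\<in>J. a U * b V * fourier_entry S P U V)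
      = (\<Sum>U\<in>I. \<Sum>V\<in>J. \<Sum>T\<in>Pow S. P T * ((a U * chi U T) * (b V * chi V T)))"
    by (simp add: fourier_entry_def sum_distrib_left mult_ac)
  also have "\<dots> = (\<Sum>U\<in>I. \<Sum>T\<in>Pow S. \<Sum>V\<in>J. P T * ((a U * chi U T) * (b V * chi V T)))"
    by (intro sum.cong refl sum.swap)
  also have "\<dots> = (\<Sum>T\<in>Pow S. \<Sum>U\<in>I. \<Sum>V\<in>J. P T * ((a U * chi U T) * (b V * chi V T)))"
    by (rule sum.swap)
  also have "\<dots> = (\<Sum>T\<in>Pow S. P T * (?f T * ?g T))"
    by (simp only: sum_product) (simp only: sum_distrib_left)
  finally have "\<bar>\<Sum>U\<in>I. \<Sum>V\<in>J. a U * b V * fourier_entry S P U V\<bar>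
      \<le> (\<Sum>T\<in>Pow S. \<bar>P T * (?f T * ?g T)\<bar>)"
    by simp
  also have "\<dots> \<le> (\<Sum>T\<in>Pow S. ((?f T)\<^sup>2 + (?g T)\<^sup>2) / 2)"
  proof (rule sum_mono)
    fix T assume "T \<in> Pow S"
    then have "\<bar>P T * (?f T * ?g T)\<bar> \<le> \<bar>?f T * ?g T\<bar>"
      using P[of T] by (simp add: abs_mult mult_left_le_one_le)
    also have "\<dots> \<le> ((?f T)\<^sup>2 + (?g T)\<^sup>2) / 2"
      using sum_squares_bound[of "\<bar>?f T\<bar>" "\<bar>?g T\<bar>"] by (simp add: abs_mult)
    finally show "\<bar>P T * (?f T * ?g T)\<bar> \<le> ((?f T)\<^sup>2 + (?g T)\<^sup>2) / 2" .
  qed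
  also have "\<dots> = 2 ^ card S * ((\<Sum>U\<in>I. (a U)\<^sup>2) + (\<Sum>V\<in>J. (b V)\<^sup>2)) / 2"
    using assms by (simp add: parseval sum.distrib algebra_simps flip: sum_divide_distrib)
  finally show ?thesis .
qed

section \<open>The commutator with a polynomial of low degree\<close>

text \<open>
  This replaces the Fejer kernel in Bernstein's inequality: a difference of levels which is at most
  \<open>d\<close> is a signed count of pairs of adjacent windows of length \<open>d\<close>, and each level lies in at most \<open>d\<close>
  windows of each kind. The commutator thus splits into blocks between orthogonal projections of
  bounded overlap.
\<close>

lemma diff_eq_sum_windows:
  fixes a b d s :: nat
  assumes "a \<le> s" "b \<le> s" "a \<le> b + d" "b \<le> a + d"
  shows "real b - real a =
    (\<Sum>j=1..s. of_bool (a < j \<and> j \<le> a + d) * of_bool (j \<le> b \<and> b < j + d)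
             - of_bool (j \<le> a \<and> a < j + d) * of_bool (b < j \<and> j \<le> b + d))"
proof -
  \<comment> \<open>One orientation: x < j <= y already implies the other window conditions, so the
    sum counts the truncated difference. At most one of the two orientations contributes.\<close>
  have *: "(\<Sum>j=1..s. of_bool (x < j \<and> j \<le> x + d) * of_bool (j \<le> y \<and> y < j + d)) = real (y - x)"
    if "x \<le> s" "y \<le> s" "x \<le> y + d" "y \<le> x + d" for x y :: nat
  proof -
    have "(\<Sum>j=1..s. of_bool (x < j \<and> j \<le> x + d) * of_bool (j \<le> y \<and> y < j + d))
        = (\<Sum>j=1..s. of_bool (j \<in> {x<..y}) :: real)"
      by (rule sum.cong) (use that in auto)
    also have "\<dots> = real (card ({1..s} \<inter> {x<..y}))"
      by (simp del: greaterThanAtMost_iff)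
    also have "{1..s} \<inter> {x<..y} = {x<..y}"
      using that by auto
    finally show ?thesis by simp
  qed
  show ?thesis
    unfolding sum_subtractf using *[of a b] *[of b a] assms
    by (simp add: mult.commute of_nat_diff split: nat_diff_split)
qed

lemma window_count_le:
  fixes s :: nat
  shows "(\<Sum>j=1..s. of_bool (a < j \<and> j \<le> a + d)) \<le> real d"
    and "(\<Sum>j=1..s. of_bool (j \<le> a \<and> a < j + d)) \<le> real d"
proof -
  have "card {j\<in>{1..s}. a < j \<and> j \<le> a + d} \<le> card {a<..a+d}"
    by (rule card_mono) auto
  then show "(\<Sum>j=1..s. of_bool (a < j \<and> j \<le> a + d)) \<le> real d"
    by (simp add: Int_def)
  have "card {j\<in>{1..s}. j \<le> a \<and> a < j + d} \<le> card {Suc a - d..<Suc a}"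
    by (rule card_mono) auto
  also have "\<dots> \<le> d" by simp
  finally show "(\<Sum>j=1..s. of_bool (j \<le> a \<and> a < j + d)) \<le> real d"
    by (simp add: Int_def)
qed

lemma sum_window_squares_le:
  fixes r :: "nat \<Rightarrow> 'b \<Rightarrow> bool" and a :: "'b \<Rightarrow> real"
  assumes "finite X" "\<And>U. U \<in> X \<Longrightarrow> (\<Sum>j=1..s. of_bool (r j U)) \<le> real d"
  shows "(\<Sum>j=1..s. \<Sum>U\<in>{U\<in>X. r j U}. (a U)\<^sup>2) \<le> real d * (\<Sum>U\<in>X. (a U)\<^sup>2)"
proof -
  have "(\<Sum>j=1..s. \<Sum>U\<in>{U\<in>X. r j U}. (a U)\<^sup>2) = (\<Sum>j=1..s. \<Sum>U\<in>X. of_bool (r j U) * (a U)\<^sup>2)"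
    using assms(1) by (intro sum.cong refl sum.mono_neutral_cong_left) auto
  also have "\<dots> = (\<Sum>U\<in>X. (\<Sum>j=1..s. of_bool (r j U)) * (a U)\<^sup>2)"
    by (subst sum.swap) (simp add: sum_distrib_right)
  also have "\<dots> \<le> (\<Sum>U\<in>X. real d * (a U)\<^sup>2)"
    by (intro sum_mono mult_right_mono assms) auto
  finally show ?thesis by (simp add: sum_distrib_left)
qed

text \<open>Four families of squared norms arise, each with overlap at most \<open>d\<close>; the
  factor 1/2 from \<open>fourier_block_bound\<close> reduces their total to \<open>d\<close> times
  the two full squared norms.\<close>

lemma level_commutator_bound:
  assumes S: "finite S" and P: "\<And>T. T \<subseteq> S \<Longrightarrow> \<bar>P T\<bar> \<le> 1"
    and band: "\<And>U V. U \<subseteq> S \<Longrightarrow> V \<subseteq> S \<Longrightarrow> card U + d < card V \<Longrightarrow> fourier_entry S P U V = 0"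
  shows "\<bar>\<Sum>U\<in>Pow S. \<Sum>V\<in>Pow S. a U * b V * ((real (card V) - real (card U)) * fourier_entry S P U V)\<bar>
     \<le> 2 ^ card S * (real d * ((\<Sum>U\<in>Pow S. (a U)\<^sup>2) + (\<Sum>V\<in>Pow S. (b V)\<^sup>2)))"
proof -
  define s where "s = card S"
  \<comment> \<open>\<open>lo j\<close> selects the \<open>d\<close> levels just below
    \<open>j\<close>, and \<open>hi j\<close> the \<open>d\<close> levels from \<open>j\<close>
    upwards.\<close>
  define lo where "lo = (\<lambda>j U. card (U :: 'a set) < j \<and> j \<le> card U + d)"
  define hi where "hi = (\<lambda>j U. j \<le> card (U :: 'a set) \<and> card U < j + d)"
  define L where "L = (\<lambda>j. {U\<in>Pow S. lo j U})"
  define H where "H = (\<lambda>j. {U\<in>Pow S. hi j U})"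
  let ?K = "fourier_entry S P"
  let ?N = "2 ^ card S :: real"
  define A where "A = (\<Sum>U\<in>Pow S. (a U)\<^sup>2)"
  define B where "B = (\<Sum>U\<in>Pow S. (b U)\<^sup>2)"
  define lh where "lh = (\<lambda>j. \<Sum>U\<in>L j. \<Sum>V\<in>H j. a U * b V * ?K U V)"
  define hl where "hl = (\<lambda>j. \<Sum>U\<in>H j. \<Sum>V\<in>L j. a U * b V * ?K U V)"
  have restrict: "(\<Sum>U\<in>{U\<in>Pow S. r U}. \<Sum>V\<in>{V\<in>Pow S. r' V}. a U * b V * ?K U V)
     = (\<Sum>U\<in>Pow S. \<Sum>V\<in>Pow S. a U * b V * (of_bool (r U) * of_bool (r' V) * ?K U V))" for r r'
  proof -
    have "(\<Sum>U\<in>{U\<in>Pow S. r U}. \<Sum>V\<in>{V\<in>Pow S. r' V}. a U * b V * ?K U V)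
        = (\<Sum>U\<in>{U\<in>Pow S. r U}. \<Sum>V\<in>Pow S. a U * b V * (of_bool (r U) * of_bool (r' V) * ?K U V))"
      using S by (intro sum.cong refl sum.mono_neutral_cong_left) auto
    also have "\<dots> = (\<Sum>U\<in>Pow S. \<Sum>V\<in>Pow S. a U * b V * (of_bool (r U) * of_bool (r' V) * ?K U V))"
      using S by (intro sum.mono_neutral_left) auto
    finally show ?thesis .
  qed
  \<comment> \<open>Within the band the window identity applies; outside it the Fourier entry is
    zero, on either side by symmetry.\<close>
  have weight: "(real (card V) - real (card U)) * ?K U V
     = (\<Sum>j=1..s. of_bool (lo j U) * of_bool (hi j V) - of_bool (hi j U) * of_bool (lo j V)) * ?K U V"
    if "U \<subseteq> S" "V \<subseteq> S" for U V
  proof (cases "card U \<le> card V + d \<and> card V \<le> card U + d")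
    case True
    have "card U \<le> s" "card V \<le> s" using that S by (auto simp: s_def card_mono)
    then show ?thesis
      using True by (subst diff_eq_sum_windows[of _ s _ d]) (auto simp: lo_def hi_def)
  next
    case False
    then have "?K U V = 0"
      using band[of U V] band[of V U] that fourier_entry_commute[of S P U V] by linarith
    then show ?thesis by simp
  qed
  have expand: "a U * b V * ((real (card V) - real (card U)) * ?K U V)
     = (\<Sum>j=1..s. a U * b V * (of_bool (lo j U) * of_bool (hi j V) * ?K U V)
       - a U * b V * (of_bool (hi j U) * of_bool (lo j V) * ?K U V))"
    if "U \<subseteq> S" "V \<subseteq> S" for U V
    unfolding weight[OF that] sum_distrib_right sum_distrib_left
    by (simp only: left_diff_distrib right_diff_distrib)
  have "(\<Sum>U\<in>Pow S. \<Sum>V\<in>Pow S. a U * b V * ((real (card V) - real (card U)) * ?K U V))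
    = (\<Sum>U\<in>Pow S. \<Sum>V\<in>Pow S. \<Sum>j=1..s.
         a U * b V * (of_bool (lo j U) * of_bool (hi j V) * ?K U V)
       - a U * b V * (of_bool (hi j U) * of_bool (lo j V) * ?K U V))"
    by (intro sum.cong refl) (simp only: Pow_iff expand)
  also have "\<dots> = (\<Sum>U\<in>Pow S. \<Sum>j=1..s. \<Sum>V\<in>Pow S.
         a U * b V * (of_bool (lo j U) * of_bool (hi j V) * ?K U V)
       - a U * b V * (of_bool (hi j U) * of_bool (lo j V) * ?K U V))"
    by (intro sum.cong refl sum.swap)
  also have "\<dots> = (\<Sum>j=1..s. \<Sum>U\<in>Pow S. \<Sum>V\<in>Pow S.
         a U * b V * (of_bool (lo j U) * of_bool (hi j V) * ?K U V)
       - a U * b V * (of_bool (hi j U) * of_bool (lo j V) * ?K U V))"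
    by (rule sum.swap)
  also have "\<dots> = (\<Sum>j=1..s. lh j - hl j)"
    unfolding lh_def hl_def L_def H_def restrict by (simp add: sum_subtractf)
  finally have sum_eq: "(\<Sum>U\<in>Pow S. \<Sum>V\<in>Pow S. a U * b V * ((real (card V) - real (card U)) * ?K U V))
     = (\<Sum>j=1..s. lh j - hl j)" .
  have win: "(\<Sum>j=1..s. \<Sum>U\<in>L j. (c U)\<^sup>2) \<le> real d * (\<Sum>U\<in>Pow S. (c U)\<^sup>2)"
    "(\<Sum>j=1..s. \<Sum>U\<in>H j. (c U)\<^sup>2) \<le> real d * (\<Sum>U\<in>Pow S. (c U)\<^sup>2)" for c
    unfolding L_def H_def using S
    by (auto intro!: sum_window_squares_le simp only: lo_def hi_def window_count_le finite_Pow_iff)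
  have "\<bar>\<Sum>U\<in>Pow S. \<Sum>V\<in>Pow S. a U * b V * ((real (card V) - real (card U)) * ?K U V)\<bar>
     \<le> (\<Sum>j=1..s. \<bar>lh j - hl j\<bar>)"
    unfolding sum_eq by (rule sum_abs)
  also have "\<dots> \<le> (\<Sum>j=1..s. ?N / 2 * ((\<Sum>U\<in>L j. (a U)\<^sup>2) + (\<Sum>V\<in>H j. (b V)\<^sup>2)
        + (\<Sum>U\<in>H j. (a U)\<^sup>2) + (\<Sum>V\<in>L j. (b V)\<^sup>2)))"
  proof (rule sum_mono)
    fix j
    have "L j \<subseteq> Pow S" "H j \<subseteq> Pow S" by (auto simp: L_def H_def)
    from fourier_block_bound[of S "L j" "H j" P a b, OF S this P]
      fourier_block_bound[of S "H j" "L j" P a b, OF S this(2,1) P]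
    show "\<bar>lh j - hl j\<bar> \<le> ?N / 2 * ((\<Sum>U\<in>L j. (a U)\<^sup>2) + (\<Sum>V\<in>H j. (b V)\<^sup>2)
        + (\<Sum>U\<in>H j. (a U)\<^sup>2) + (\<Sum>V\<in>L j. (b V)\<^sup>2))"
      unfolding lh_def hl_def by (simp add: algebra_simps)
  qed
  also have "\<dots> = ?N / 2 * ((\<Sum>j=1..s. \<Sum>U\<in>L j. (a U)\<^sup>2) + (\<Sum>j=1..s. \<Sum>V\<in>H j. (b V)\<^sup>2)
        + (\<Sum>j=1..s. \<Sum>U\<in>H j. (a U)\<^sup>2) + (\<Sum>j=1..s. \<Sum>V\<in>L j. (b V)\<^sup>2))"
    by (simp only: sum_distrib_left[symmetric] sum.distrib)
  also have "\<dots> \<le> ?N / 2 * (real d * A + real d * B + real d * A + real d * B)"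
    unfolding A_def B_def by (intro mult_left_mono add_mono win) simp
  also have "\<dots> = ?N * (real d * (A + B))"
    by (simp add: algebra_simps)
  finally show ?thesis unfolding A_def B_def .
qed

section \<open>The commutator in the character basis\<close>

lemma sum_signs_eq:
  assumes "finite S" "U \<subseteq> S"
  shows "(\<Sum>i\<in>S. if i \<in> U then -1 else 1) = real (card S) - 2 * real (card U)"
proof -
  have "(\<Sum>i\<in>S. if i \<in> U then -1 else 1 :: real) = (\<Sum>i\<in>S. 1 - 2 * of_bool (i \<in> U))"
    by (rule sum.cong) auto
  also have "\<dots> = real (card S) - 2 * real (card (S \<inter> U))"
    using assms(1) by (simp add: sum_subtractf flip: sum_distrib_left)
  also have "S \<inter> U = U" using assms(2) by auto
  finally show ?thesis .
qed

text \<open>Reindexing by the flip moves it onto \<open>chi U\<close>. Characters are eigenfunctions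
  of the adjacency operator, and the eigenvalues at \<open>U\<close> and \<open>V\<close> differ by
  \<open>2 * (card V - card U)\<close>.\<close>

lemma chi_commutator:
  assumes S: "finite S" and UV: "U \<subseteq> S" "V \<subseteq> S"
  shows "(\<Sum>T\<in>Pow S. \<Sum>i\<in>S. chi U T * (P (flip i T) - P T) * chi V (flip i T))
     = 2 * ((real (card V) - real (card U)) * fourier_entry S P U V)"
proof -
  have fin: "finite U" "finite V" using assms by (auto intro: finite_subset)
  let ?K = "fourier_entry S P U V"
  have "(\<Sum>T\<in>Pow S. \<Sum>i\<in>S. chi U T * (P (flip i T) - P T) * chi V (flip i T))
      = (\<Sum>i\<in>S. \<Sum>T\<in>Pow S. chi U T * (P (flip i T) - P T) * chi V (flip i T))"
    by (rule sum.swap)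
  also have "\<dots> = (\<Sum>i\<in>S. ((if i \<in> U then -1 else 1) - (if i \<in> V then -1 else 1)) * ?K)"
  proof (rule sum.cong[OF refl])
    fix i assume i: "i \<in> S"
    have "(\<Sum>T\<in>Pow S. chi U T * (P (flip i T) - P T) * chi V (flip i T))
        = (\<Sum>T\<in>Pow S. chi U (flip i (flip i T)) * P (flip i T) * chi V (flip i T))
        - (\<Sum>T\<in>Pow S. chi U T * P T * chi V (flip i T))"
      by (simp add: algebra_simps sum_subtractf)
    also have "(\<Sum>T\<in>Pow S. chi U (flip i (flip i T)) * P (flip i T) * chi V (flip i T))
        = (\<Sum>T\<in>Pow S. chi U (flip i T) * P T * chi V T)"
      by (rule sum_flip[OF i, where h = "\<lambda>T. chi U (flip i T) * P T * chi V T"])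
    also have "\<dots> = (if i \<in> U then -1 else 1) * ?K"
      by (simp add: chi_flip fin fourier_entry_def sum_distrib_left mult_ac)
    also have "(\<Sum>T\<in>Pow S. chi U T * P T * chi V (flip i T)) = (if i \<in> V then -1 else 1) * ?K"
      by (simp add: chi_flip fin fourier_entry_def sum_distrib_left mult_ac)
    finally show "(\<Sum>T\<in>Pow S. chi U T * (P (flip i T) - P T) * chi V (flip i T))
        = ((if i \<in> U then -1 else 1) - (if i \<in> V then -1 else 1)) * ?K"
      by (simp add: left_diff_distrib)
  qed
  also have "\<dots> = 2 * ((real (card V) - real (card U)) * ?K)"
    unfolding sum_distrib_right[symmetric] sum_subtractf sum_signs_eq[OF S UV(1)] sum_signs_eq[OF S UV(2)]
    by (simp add: algebra_simps)
  finally show ?thesis .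
qed

lemma sum_swap_pairs:
  "(\<Sum>w\<in>A. \<Sum>x\<in>B. \<Sum>y\<in>C. \<Sum>z\<in>D. f w x y z) = (\<Sum>y\<in>C. \<Sum>z\<in>D. \<Sum>w\<in>A. \<Sum>x\<in>B. f w x y z)"
proof -
  have "(\<Sum>w\<in>A. \<Sum>x\<in>B. \<Sum>y\<in>C. \<Sum>z\<in>D. f w x y z) = (\<Sum>w\<in>A. \<Sum>y\<in>C. \<Sum>z\<in>D. \<Sum>x\<in>B. f w x y z)"
    by (intro sum.cong refl trans[OF sum.swap] sum.swap)
  also have "\<dots> = (\<Sum>y\<in>C. \<Sum>w\<in>A. \<Sum>z\<in>D. \<Sum>x\<in>B. f w x y z)"
    by (rule sum.swap)
  also have "\<dots> = (\<Sum>y\<in>C. \<Sum>z\<in>D. \<Sum>w\<in>A. \<Sum>x\<in>B. f w x y z)"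
    by (intro sum.cong refl sum.swap)
  finally show ?thesis .
qed

text \<open>The left side is the bilinear form of the commutator \<open>[A, P]\<close> at
  \<open>u\<close> and \<open>v\<close>; for unit vectors the bound reads
  \<open>4 * d\<close>.\<close>

lemma commutator_bound:
  assumes S: "finite S" and P: "\<And>T. T \<subseteq> S \<Longrightarrow> \<bar>P T\<bar> \<le> 1"
    and band: "\<And>U V. U \<subseteq> S \<Longrightarrow> V \<subseteq> S \<Longrightarrow> card U + d < card V \<Longrightarrow> fourier_entry S P U V = 0"
  shows "(\<Sum>T\<in>Pow S. \<Sum>i\<in>S. u T * (P (flip i T) - P T) * v (flip i T))
     \<le> 2 * real d * ((\<Sum>T\<in>Pow S. (u T)\<^sup>2) + (\<Sum>T\<in>Pow S. (v T)\<^sup>2))"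
proof -
  define N where "N = (2 ^ card S :: real)"
  have N: "N > 0" by (simp add: N_def)
  define a where "a = (\<lambda>U. \<Sum>W\<in>Pow S. u W * chi W U)"
  define b where "b = (\<lambda>U. \<Sum>W\<in>Pow S. v W * chi W U)"
  define A where "A = (\<Sum>T\<in>Pow S. (u T)\<^sup>2)"
  define B where "B = (\<Sum>T\<in>Pow S. (v T)\<^sup>2)"
  define Q where "Q = (\<Sum>T\<in>Pow S. \<Sum>i\<in>S. u T * (P (flip i T) - P T) * v (flip i T))"
  let ?e = "\<lambda>T i. P (flip i T) - P T"
  \<comment> \<open>Expanding both vectors costs a factor \<open>N\<close> each; the level bound and
    Parseval give one \<open>N\<close> back each.\<close>
  have inv: "(\<Sum>U\<in>Pow S. a U * chi U T) = N * u T" "(\<Sum>U\<in>Pow S. b U * chi U T) = N * v T"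
    if "T \<subseteq> S" for T
    unfolding a_def b_def N_def using S that by (rule fourier_inversion)+
  have norm: "(\<Sum>U\<in>Pow S. (a U)\<^sup>2) = N * A" "(\<Sum>U\<in>Pow S. (b U)\<^sup>2) = N * B"
    unfolding a_def b_def A_def B_def N_def using S by (auto intro!: parseval)
  have "N\<^sup>2 * Q = (\<Sum>T\<in>Pow S. \<Sum>i\<in>S. (N * u T) * ?e T i * (N * v (flip i T)))"
    by (simp add: Q_def sum_distrib_left power2_eq_square mult_ac)
  also have "\<dots> = (\<Sum>T\<in>Pow S. \<Sum>i\<in>S. (\<Sum>U\<in>Pow S. a U * chi U T) * ?e T i *
      (\<Sum>V\<in>Pow S. b V * chi V (flip i T)))"
    by (intro sum.cong refl) (simp add: inv flip_subset_iff)
  also have "\<dots> = (\<Sum>T\<in>Pow S. \<Sum>i\<in>S. \<Sum>U\<in>Pow S. \<Sum>V\<in>Pow S.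
      a U * b V * (chi U T * ?e T i * chi V (flip i T)))"
    by (simp only: sum_distrib_left sum_distrib_right, subst (2) sum.swap)
      (intro sum.cong refl, simp only: mult_ac)
  also have "\<dots> = (\<Sum>U\<in>Pow S. \<Sum>V\<in>Pow S. a U * b V *
      (\<Sum>T\<in>Pow S. \<Sum>i\<in>S. chi U T * ?e T i * chi V (flip i T)))"
    unfolding sum_distrib_left by (rule sum_swap_pairs)
  also have "\<dots> = (\<Sum>U\<in>Pow S. \<Sum>V\<in>Pow S. 2 * (a U * b V *
      ((real (card V) - real (card U)) * fourier_entry S P U V)))"
    by (intro sum.cong refl) (simp add: chi_commutator[OF S])
  also have "\<dots> = 2 * (\<Sum>U\<in>Pow S. \<Sum>V\<in>Pow S. a U * b V *
      ((real (card V) - real (card U)) * fourier_entry S P U V))"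
    by (simp only: sum_distrib_left)
  also have "\<dots> \<le> 2 * (N * (real d * (N * A + N * B)))"
    using level_commutator_bound[where d = d and a = a and b = b, OF S P band] unfolding norm N_def[symmetric] by simp
  also have "\<dots> = N\<^sup>2 * (2 * real d * (A + B))"
    by (simp add: power2_eq_square algebra_simps)
  finally have "Q \<le> 2 * real d * (A + B)"
    using N by simp
  then show ?thesis unfolding Q_def A_def B_def .
qed

text \<open>\<open>g m\<close> is the variable set of a monomial. \<open>V\<close> is too large to
  fit into \<open>U \<union> g m\<close>, and flipping an element of \<open>V\<close> outside that
  union negates only \<open>chi V\<close>.\<close>

lemma fourier_entry_low_degree:
  assumes S: "finite S" "U \<subseteq> S" "V \<subseteq> S" and d: "card U + d < card V"
    and P: "\<And>T. T \<subseteq> S \<Longrightarrow> P T = (\<Sum>m\<in>M. c m * of_bool (g m \<subseteq> T))"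
    and g: "\<And>m. m \<in> M \<Longrightarrow> finite (g m) \<and> card (g m) \<le> d"
  shows "fourier_entry S P U V = 0"
proof -
  have fin: "finite U" using S by (auto intro: finite_subset)
  have "fourier_entry S P U V
      = (\<Sum>T\<in>Pow S. \<Sum>m\<in>M. c m * (of_bool (g m \<subseteq> T) * chi U T * chi V T))"
    unfolding fourier_entry_def by (intro sum.cong refl) (simp add: P sum_distrib_right mult.assoc)
  also have "\<dots> = (\<Sum>m\<in>M. c m * (\<Sum>T\<in>Pow S. of_bool (g m \<subseteq> T) * chi U T * chi V T))"
    by (subst sum.swap) (simp add: sum_distrib_left)
  also have "\<dots> = 0"
  proof (rule sum.neutral, rule ballI)
    fix m assume m: "m \<in> M"
    have "card (U \<union> g m) \<le> card U + card (g m)" by (rule card_Un_le)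
    also have "\<dots> < card V" using d g[OF m] by simp
    finally have "\<not> V \<subseteq> U \<union> g m"
      using card_mono[of "U \<union> g m" V] fin g[OF m] by auto
    then obtain i where i: "i \<in> V" "i \<notin> U" "i \<notin> g m" by blast
    then have "(\<Sum>T\<in>Pow S. of_bool (g m \<subseteq> T) * chi U T * chi V T) = 0"
      using S by (intro sum_chi_chi_invariant_eq_0[of S U V i]) (auto simp: flip_def)
    then show "c m * (\<Sum>T\<in>Pow S. of_bool (g m \<subseteq> T) * chi U T * chi V T) = 0" by simp
  qed
  finally show ?thesis .
qed

section \<open>Huang's signed hypercube matrix\<close>

text \<open>Gaussian elimination by one equation at a time: a nonzero coefficient eliminates one
  unknown, so the surplus of unknowns persists.\<close>

lemma homogeneous_system_nontrivial:
  fixes a :: "'e \<Rightarrow> 'v \<Rightarrow> 'k :: field"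
  assumes "finite E" "finite V" "card E < card V"
  shows "\<exists>z. (\<exists>v\<in>V. z v \<noteq> 0) \<and> (\<forall>e\<in>E. (\<Sum>v\<in>V. a e v * z v) = 0)"
  using assms
proof (induction E arbitrary: V a rule: finite_induct)
  case empty
  then have "V \<noteq> {}" by auto
  then show ?case by (intro exI[of _ "\<lambda>_. 1"]) auto
next
  case (insert e E)
  show ?case
  proof (cases "\<forall>v\<in>V. a e v = 0")
    case True
    with insert.IH[of V a] insert.prems insert.hyps show ?thesis by auto
  next
    case False
    then obtain p where p: "p \<in> V" "a e p \<noteq> 0" by blast
    define W where "W = V - {p}"
    have W: "finite W" "p \<notin> W" "V = insert p W" using insert.prems p by (auto simp: W_def)
    have "card E < card W" using insert.prems insert.hyps W by simp
    from insert.IH[OF W(1) this, of "\<lambda>e' v. a e' v - a e' p * a e v / a e p"]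
    obtain z where z: "\<exists>v\<in>W. z v \<noteq> 0"
      "\<And>e'. e' \<in> E \<Longrightarrow> (\<Sum>v\<in>W. (a e' v - a e' p * a e v / a e p) * z v) = 0" by blast
    define t where "t = - (\<Sum>v\<in>W. a e v * z v) / a e p"
    have sum_eq: "(\<Sum>v\<in>V. a e' v * (z(p := t)) v) = a e' p * t + (\<Sum>v\<in>W. a e' v * z v)" for e'
    proof -
      have "(\<Sum>v\<in>W. a e' v * (z(p := t)) v) = (\<Sum>v\<in>W. a e' v * z v)"
        using W by (intro sum.cong) auto
      then show ?thesis using W by simp
    qed
    have "(\<Sum>v\<in>V. a e' v * (z(p := t)) v) = 0" if "e' \<in> insert e E" for e'
    proof (cases "e' = e")
      case True
      then show ?thesis unfolding sum_eq using p by (simp add: t_def)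
    next
      case False
      then have "0 = (\<Sum>v\<in>W. (a e' v - a e' p * a e v / a e p) * z v)" using z that by simp
      also have "\<dots> = (\<Sum>v\<in>W. a e' v * z v) - (\<Sum>v\<in>W. a e' p / a e p * (a e v * z v))"
        by (simp add: left_diff_distrib sum_subtractf mult.assoc)
      also have "\<dots> = (\<Sum>v\<in>W. a e' v * z v) + a e' p * t"
        by (simp add: t_def sum_distrib_left sum_divide_distrib sum_negf)
      finally show ?thesis unfolding sum_eq by (simp add: add.commute)
    qed
    moreover have "\<exists>v\<in>V. (z(p := t)) v \<noteq> 0"
      using z(1) W by auto
    ultimately show ?thesis by blast
  qed
qed

text \<open>
  The sign of the edge in direction \<open>i\<close> at \<open>T\<close> is the parity of the elements of \<open>T\<close> below \<open>i\<close>; this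
  makes the signed flips in different directions anticommute.
\<close>

definition huang_op :: "'a :: linorder set \<Rightarrow> ('a set \<Rightarrow> real) \<Rightarrow> 'a set \<Rightarrow> real" where
  "huang_op S w T = (\<Sum>i\<in>S. chi {j\<in>S. j < i} T * w (flip i T))"

lemma huang_op_add: "huang_op S (\<lambda>T. v T + w T) T = huang_op S v T + huang_op S w T"
  by (simp add: huang_op_def algebra_simps sum.distrib)

lemma huang_op_scale: "huang_op S (\<lambda>T. r * w T) T = r * huang_op S w T"
  by (simp add: huang_op_def mult_ac sum_distrib_left)

text \<open>Each signed flip squares to the identity and distinct ones anticommute, so only the
  diagonal terms survive once the double sum is symmetrized.\<close>

lemma huang_op_huang_op:
  assumes S: "finite S"
  shows "huang_op S (huang_op S w) T = real (card S) * w T"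
proof -
  define t where "t = (\<lambda>i j. chi {k\<in>S. k < i} T * (chi {k\<in>S. k < j} (flip i T) * w (flip j (flip i T))))"
  have t: "t i j + t j i = (if i = j then 2 * w T else 0)" if "i \<in> S" "j \<in> S" for i j
  proof (cases "i = j")
    case True
    then show ?thesis using S by (simp add: t_def chi_flip flip: mult.assoc)
  next
    case False
    \<comment> \<open>For i < j, flipping \<open>i\<close> negates the sign of direction
      \<open>j\<close>, while flipping \<open>j\<close> preserves that of direction
      \<open>i\<close>.\<close>
    then show ?thesis
      using S that by (cases "i < j") (auto simp: t_def chi_flip flip_commute[of i j])
  qed
  define X where "X = (\<Sum>i\<in>S. \<Sum>j\<in>S. t i j)"
  have "X = (\<Sum>i\<in>S. \<Sum>j\<in>S. t j i)" unfolding X_def by (rule sum.swap)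
  then have "2 * X = (\<Sum>i\<in>S. \<Sum>j\<in>S. t i j + t j i)" by (simp add: sum.distrib X_def)
  also have "\<dots> = (\<Sum>i\<in>S. \<Sum>j\<in>S. if i = j then 2 * w T else 0)"
    by (intro sum.cong refl t)
  also have "\<dots> = 2 * (real (card S) * w T)" using S by simp
  finally have "X = real (card S) * w T" by simp
  then show ?thesis by (simp add: X_def t_def huang_op_def sum_distrib_left)
qed

text \<open>The eigenspace has dimension at least half of \<open>2 ^ card S\<close>, so it meets the
  functions supported on a larger set nontrivially. This dimension count replaces eigenvalue
  interlacing.\<close>

lemma huang_eigenvector:
  fixes S :: "'a :: linorder set"
  assumes S: "finite S" "S \<noteq> {}" and H: "H \<subseteq> Pow S" "2 ^ card S < 2 * card H"
  obtains w where "\<exists>T\<in>Pow S. w T \<noteq> 0" "\<And>T. T \<subseteq> S \<Longrightarrow> T \<notin> H \<Longrightarrow> w T = 0"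
    "\<And>T. huang_op S w T = sqrt (card S) * w T"
proof -
  define r where "r = sqrt (real (card S))"
  have r: "r * r = real (card S)" by (simp add: r_def)
  obtain m where m: "m \<in> S" using S by blast
  \<comment> \<open>Every \<open>(B + r) z\<close> is an eigenvector of the matrix \<open>B\<close>. For \<open>z\<close> supported on the half cube \<open>V\<close>
    it is nonzero, and it vanishes off \<open>H\<close> if fewer than \<open>card V\<close> linear equations hold.\<close>
  define V where "V = Pow (S - {m})"
  have finV: "finite V" using S by (simp add: V_def)
  define \<delta> where "\<delta> = (\<lambda>v T :: 'a set. of_bool (T = v) :: real)"
  define a where "a = (\<lambda>T v. huang_op S (\<delta> v) T + r * \<delta> v T)"
  have cardS: "card S = Suc (card (S - {m}))" using card_Suc_Diff1[OF S(1) m] by simp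
  \<comment> \<open>Fewer than half of the points lie outside \<open>H\<close>, and \<open>V\<close>
    is exactly half, so unknowns outnumber equations.\<close>
  have "card (Pow S - H) = 2 ^ card S - card H"
    using H S by (subst card_Diff_subset) (auto simp: card_Pow intro: finite_subset)
  also have "\<dots> < card V"
    using H(2) zero_less_power[of "2 :: nat" "card (S - {m})"]
    unfolding V_def cardS card_Pow[OF finite_Diff[OF S(1)]] power_Suc by linarith
  finally obtain z where z: "\<exists>v\<in>V. z v \<noteq> 0" "\<forall>T\<in>Pow S - H. (\<Sum>v\<in>V. a T v * z v) = 0"
    using homogeneous_system_nontrivial[of "Pow S - H" V a] S finV by auto
  define z0 where "z0 = (\<lambda>T. \<Sum>v\<in>V. z v * \<delta> v T)"
  have z0: "z0 T = (if T \<in> V then z T else 0)" for T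
    using finV by (simp add: z0_def \<delta>_def sum.delta)
  define w where "w = (\<lambda>T. huang_op S z0 T + r * z0 T)"
  have w_eq: "w T = (\<Sum>v\<in>V. a T v * z v)" for T
  proof -
    have "huang_op S z0 T = (\<Sum>i\<in>S. \<Sum>v\<in>V. chi {j\<in>S. j < i} T * \<delta> v (flip i T) * z v)"
      unfolding huang_op_def z0_def sum_distrib_left by (simp only: mult_ac)
    also have "\<dots> = (\<Sum>v\<in>V. huang_op S (\<delta> v) T * z v)"
      by (subst sum.swap) (simp add: huang_op_def sum_distrib_right)
    finally show ?thesis
      by (simp add: w_def a_def z0_def algebra_simps sum.distrib sum_distrib_left)
  qed
  show thesis
  proof
    \<comment> \<open>\<open>z0\<close> vanishes at \<open>insert m v\<close>, and only the flip of
      \<open>m\<close> leads from there into \<open>V\<close>, so \<open>w\<close> picks up a single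
      term.\<close>
    obtain v where v: "v \<in> V" "z v \<noteq> 0" using z(1) by blast
    then have mv: "m \<notin> v" "v \<subseteq> S" by (auto simp: V_def)
    have "huang_op S z0 (insert m v) = (\<Sum>i\<in>S. if i = m then chi {j\<in>S. j < m} (insert m v) * z v else 0)"
      unfolding huang_op_def
    proof (rule sum.cong[OF refl])
      fix i assume "i \<in> S"
      have "flip m (insert m v) = v" using mv by (auto simp: flip_def)
      moreover have "m \<in> flip i (insert m v)" if "i \<noteq> m" using that by (auto simp: flip_def)
      ultimately show "chi {j\<in>S. j < i} (insert m v) * z0 (flip i (insert m v))
          = (if i = m then chi {j\<in>S. j < m} (insert m v) * z v else 0)"
        using v by (auto simp: z0 V_def)
    qed
    also have "\<dots> = chi {j\<in>S. j < m} (insert m v) * z v" using S m by simp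
    finally have "w (insert m v) = chi {j\<in>S. j < m} (insert m v) * z v"
      by (simp add: w_def z0 V_def)
    then have "w (insert m v) \<noteq> 0" using v by (simp add: chi_nonzero)
    then show "\<exists>T\<in>Pow S. w T \<noteq> 0" using mv m by auto
    show "w T = 0" if "T \<subseteq> S" "T \<notin> H" for T
      using z(2) that by (simp add: w_eq)
    show "huang_op S w T = sqrt (card S) * w T" for T
    proof -
      have "huang_op S w T = huang_op S (huang_op S z0) T + r * huang_op S z0 T"
        unfolding w_def huang_op_add huang_op_scale by simp
      also have "\<dots> = r * w T"
        by (simp add: huang_op_huang_op[OF S(1)] w_def distrib_left flip: r mult.assoc)
      finally show ?thesis by (simp add: r_def)
    qed
  qed
qed

section \<open>Degree and approximate degree\<close>

text \<open>Compares Huang's quadratic form at the eigenvector with the commutator form. Up to sign,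
  \<open>nz\<close> says that the monomial \<open>S\<close> has a nonzero coefficient in
  \<open>F\<close>.\<close>

lemma full_degree_bound:
  fixes S :: "'a :: linorder set" and F :: "'a set \<Rightarrow> bool"
  assumes S: "finite S" and nz: "(\<Sum>T\<in>Pow S. (-1) ^ card T * of_bool (F T)) \<noteq> (0 :: real)"
    and P1: "\<And>T. T \<subseteq> S \<Longrightarrow> F T \<Longrightarrow> 2/3 \<le> P T \<and> P T \<le> 1"
    and P0: "\<And>T. T \<subseteq> S \<Longrightarrow> \<not> F T \<Longrightarrow> 0 \<le> P T \<and> P T \<le> 1/3"
    and band: "\<And>U V. U \<subseteq> S \<Longrightarrow> V \<subseteq> S \<Longrightarrow> card U + d < card V \<Longrightarrow> fourier_entry S P U V = 0"
  shows "card S \<le> 144 * d\<^sup>2"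
proof (cases "S = {}")
  case False
  \<comment> \<open>\<open>F\<close> as a sign, times parity. Parity alone sums to zero because
    \<open>S\<close> is nonempty, so the imbalance is that of \<open>nz\<close>.\<close>
  define \<epsilon> where "\<epsilon> = (\<lambda>T. chi S T * (if F T then 1 else -1))"
  have \<epsilon>: "\<epsilon> T = 1 \<or> \<epsilon> T = -1" for T
    by (auto simp: \<epsilon>_def chi_def minus_one_power_iff)
  have "(\<Sum>T\<in>Pow S. \<epsilon> T) = (\<Sum>T\<in>Pow S. 2 * ((-1) ^ card T * of_bool (F T)) - chi S T)"
    by (intro sum.cong) (auto simp: \<epsilon>_def chi_def Int_absorb1)
  also have "\<dots> = 2 * (\<Sum>T\<in>Pow S. (-1) ^ card T * of_bool (F T))"
    using chi_orthogonal[OF S, of S "{}"] False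
    by (simp only: sum_subtractf sum_distrib_left[symmetric]) (simp add: chi_def)
  finally have sum_nz: "(\<Sum>T\<in>Pow S. \<epsilon> T) \<noteq> 0" using nz by simp
  define \<sigma> where "\<sigma> = sgn (\<Sum>T\<in>Pow S. \<epsilon> T)"
  have \<sigma>: "\<sigma> = 1 \<or> \<sigma> = -1" using sum_nz by (auto simp: \<sigma>_def sgn_if)
  define H where "H = {T\<in>Pow S. \<epsilon> T = \<sigma>}"
  have H: "H \<subseteq> Pow S" by (auto simp: H_def)
  have "0 < \<sigma> * (\<Sum>T\<in>Pow S. \<epsilon> T)"
    using sum_nz by (auto simp: \<sigma>_def sgn_if)
  also have "\<dots> = (\<Sum>T\<in>Pow S. 2 * of_bool (T \<in> H) - 1)"
    unfolding sum_distrib_left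
  proof (rule sum.cong[OF refl])
    fix T assume "T \<in> Pow S"
    then show "\<sigma> * \<epsilon> T = 2 * of_bool (T \<in> H) - 1"
      using \<sigma> \<epsilon>[of T] by (auto simp: H_def)
  qed
  also have "\<dots> = 2 * (\<Sum>T\<in>Pow S. of_bool (T \<in> H)) - 2 ^ card S"
    using S by (simp add: sum_subtractf card_Pow sum_distrib_left)
  also have "(\<Sum>T\<in>Pow S. of_bool (T \<in> H)) = real (card H)"
    using S H by (simp add: Int_absorb1)
  finally have "2 ^ card S < 2 * real (card H)" by simp
  then have "real (2 ^ card S) < real (2 * card H)" by simp
  then have "2 ^ card S < 2 * card H" by (simp only: of_nat_less_iff)
  then obtain w where w: "\<exists>T\<in>Pow S. w T \<noteq> 0" "\<And>T. T \<subseteq> S \<Longrightarrow> T \<notin> H \<Longrightarrow> w T = 0"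
    "\<And>T. huang_op S w T = sqrt (card S) * w T"
    using huang_eigenvector[OF S False H] by blast
  define A where "A = (\<Sum>T\<in>Pow S. (w T)\<^sup>2)"
  have A: "A > 0"
  proof -
    from w(1) obtain T where "T \<in> Pow S" "w T \<noteq> 0" by blast
    then show ?thesis unfolding A_def using S by (intro sum_pos2[of _ T]) auto
  qed
  \<comment> \<open>The split confines \<open>u0 T * u1 (flip i T)\<close> to edges from value 0 to
    value 1, where the change of \<open>P\<close> has a known sign.\<close>
  define u0 where "u0 = (\<lambda>T. if F T then 0 else \<bar>w T\<bar>)"
  define u1 where "u1 = (\<lambda>T. if F T then \<bar>w T\<bar> else 0)"
  have pos: "u0 T \<ge> 0" "u1 T \<ge> 0" for T by (auto simp: u0_def u1_def)
  have "sqrt (card S) * A = (\<Sum>T\<in>Pow S. w T * huang_op S w T)"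
    by (simp add: A_def w(3) sum_distrib_left power2_eq_square mult_ac)
  also have "\<dots> = (\<Sum>T\<in>Pow S. \<Sum>i\<in>S. w T * (chi {j\<in>S. j < i} T * w (flip i T)))"
    by (simp add: huang_op_def sum_distrib_left)
  also have "\<dots> \<le> (\<Sum>T\<in>Pow S. \<Sum>i\<in>S. u0 T * u1 (flip i T) + u1 T * u0 (flip i T))"
  proof (intro sum_mono)
    fix T i assume T: "T \<in> Pow S" and i: "i \<in> S"
    show "w T * (chi {j\<in>S. j < i} T * w (flip i T)) \<le> u0 T * u1 (flip i T) + u1 T * u0 (flip i T)"
    proof (cases "T \<in> H \<and> flip i T \<in> H")
      case True
      then have "\<epsilon> T = \<epsilon> (flip i T)" by (simp add: H_def)
      \<comment> \<open>Parity changes along every edge, so equal values of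
        \<open>\<epsilon>\<close> force \<open>F\<close> to change.\<close>
      then have "F T \<longleftrightarrow> \<not> F (flip i T)"
        using S i chi_nonzero[of S T] by (auto simp: \<epsilon>_def chi_flip split: if_splits)
      then have "u0 T * u1 (flip i T) + u1 T * u0 (flip i T) = \<bar>w T\<bar> * \<bar>w (flip i T)\<bar>"
        by (auto simp: u0_def u1_def)
      also have "\<dots> = \<bar>w T * (chi {j\<in>S. j < i} T * w (flip i T))\<bar>"
        by (simp add: abs_mult chi_def power_abs)
      finally show ?thesis by simp
    next
      case False
      then have "w T = 0 \<or> w (flip i T) = 0"
        using w(2) T i by (auto simp: flip_subset_iff)
      moreover have "0 \<le> u0 T * u1 (flip i T) + u1 T * u0 (flip i T)" by (simp add: pos)
      ultimately show ?thesis by auto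
    qed
  qed
  also have "\<dots> = 2 * (\<Sum>T\<in>Pow S. \<Sum>i\<in>S. u0 T * u1 (flip i T))"
  proof -
    have "(\<Sum>T\<in>Pow S. \<Sum>i\<in>S. u1 T * u0 (flip i T)) = (\<Sum>i\<in>S. \<Sum>T\<in>Pow S. u1 T * u0 (flip i T))"
      by (rule sum.swap)
    also have "\<dots> = (\<Sum>i\<in>S. \<Sum>T\<in>Pow S. u0 T * u1 (flip i T))"
    proof (rule sum.cong[OF refl])
      fix i assume "i \<in> S"
      from sum_flip[OF this, of "\<lambda>T. u1 T * u0 (flip i T)"]
      show "(\<Sum>T\<in>Pow S. u1 T * u0 (flip i T)) = (\<Sum>T\<in>Pow S. u0 T * u1 (flip i T))"
        by (simp add: mult.commute)
    qed
    also have "\<dots> = (\<Sum>T\<in>Pow S. \<Sum>i\<in>S. u0 T * u1 (flip i T))" by (rule sum.swap)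
    finally show ?thesis by (simp add: sum.distrib)
  qed
  also have "\<dots> \<le> 2 * (\<Sum>T\<in>Pow S. \<Sum>i\<in>S. 3 * (u0 T * (P (flip i T) - P T) * u1 (flip i T)))"
  proof (intro mult_left_mono sum_mono)
    fix T i assume T: "T \<in> Pow S" and i: "i \<in> S"
    show "u0 T * u1 (flip i T) \<le> 3 * (u0 T * (P (flip i T) - P T) * u1 (flip i T))"
    proof (cases "\<not> F T \<and> F (flip i T)")
      case True
      \<comment> \<open>\<open>P\<close> rises from at most 1/3 to at least 2/3, whence the factor
        3.\<close>
      then have "1 \<le> 3 * (P (flip i T) - P T)"
        using P0[of T] P1[of "flip i T"] T i by (auto simp: flip_subset_iff)
      from mult_right_mono[OF this, of "u0 T * u1 (flip i T)"] show ?thesis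
        by (simp add: pos algebra_simps)
    qed (auto simp: u0_def u1_def)
  qed simp
  also have "\<dots> = 6 * (\<Sum>T\<in>Pow S. \<Sum>i\<in>S. u0 T * (P (flip i T) - P T) * u1 (flip i T))"
    by (simp flip: sum_distrib_left)
  also have "\<dots> \<le> 6 * (2 * real d * ((\<Sum>T\<in>Pow S. (u0 T)\<^sup>2) + (\<Sum>T\<in>Pow S. (u1 T)\<^sup>2)))"
  proof (intro mult_left_mono commutator_bound[OF S _ band])
    fix T assume "T \<subseteq> S"
    then show "\<bar>P T\<bar> \<le> 1" using P0[of T] P1[of T] by (cases "F T") auto
  qed auto
  \<comment> \<open>The supports of \<open>u0\<close> and \<open>u1\<close> are disjoint. Two
    orientations, the factor 3 and the commutator constant 2 multiply to 12, whose square is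
    144.\<close>
  also have "(\<Sum>T\<in>Pow S. (u0 T)\<^sup>2) + (\<Sum>T\<in>Pow S. (u1 T)\<^sup>2) = A"
    unfolding A_def sum.distrib[symmetric] by (intro sum.cong) (auto simp: u0_def u1_def)
  finally have "sqrt (card S) * A \<le> (12 * real d) * A" by simp
  then have "sqrt (card S) \<le> 12 * real d" using A by simp
  then have "(sqrt (card S))\<^sup>2 \<le> (12 * real d)\<^sup>2" by (intro power_mono) auto
  then have "real (card S) \<le> real (144 * d\<^sup>2)" by (simp add: power_mult_distrib)
  then show ?thesis by (simp only: of_nat_le_iff)
qed simp

text \<open>The coefficient of the monomial \<open>S\<close> in the multilinear expansion of
  \<open>f\<close>, by Moebius inversion over subsets.\<close>

definition mobius_coeff :: "((nat \<Rightarrow> bool) \<Rightarrow> bool) \<Rightarrow> nat set \<Rightarrow> real" where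
  "mobius_coeff f S = (-1) ^ card S * (\<Sum>T\<in>Pow S. (-1) ^ card T * of_bool (f (\<lambda>i. i \<in> T)))"

lemma sum_mobius_coeff:
  assumes "x \<in> cube n"
  shows "(\<Sum>S\<in>Pow {..<n}. mobius_coeff f S * (\<Prod>i\<in>S. to_real x i)) = of_bool (f x)"
proof -
  define X where "X = {i. x i}"
  have X: "X \<subseteq> {..<n}" using assms by (auto simp: X_def cube_def intro: ccontr)
  have x: "x = (\<lambda>i. i \<in> X)" by (simp add: X_def)
  have finX: "finite X" using X finite_subset by blast
  have prod: "(\<Prod>i\<in>S. to_real x i) = of_bool (S \<subseteq> X)" if "S \<subseteq> {..<n}" for S
  proof -
    have "finite S" using that finite_subset by blast
    then show ?thesis by (induction S) (auto simp: to_real_def X_def)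
  qed
  have "(\<Sum>S\<in>Pow {..<n}. mobius_coeff f S * (\<Prod>i\<in>S. to_real x i)) = (\<Sum>S\<in>Pow X. mobius_coeff f S)"
    using X by (intro sum.mono_neutral_cong_right) (auto simp: prod)
  also have "\<dots> = of_bool (f (\<lambda>i. i \<in> X))"
    unfolding mobius_coeff_def
    by (rule inclusion_exclusion_symmetric[symmetric, OF refl finX])
  finally show ?thesis using x by simp
qed

section \<open>Real polynomials and their values on the cube\<close>

lemma finite_monomials_le: "finite (monomials_le n d)"
proof (rule finite_subset)
  show "monomials_le n d \<subseteq> {a. \<forall>i. (i \<in> {..<n} \<longrightarrow> a i \<in> {..d}) \<and> (i \<notin> {..<n} \<longrightarrow> a i = 0)}"
  proof
    fix a assume a: "a \<in> monomials_le n d"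
    have "a i \<le> d" if "i < n" for i
      using a member_le_sum[of i "{..<n}" a] that by (auto simp: monomials_le_def)
    with a show "a \<in> {a. \<forall>i. (i \<in> {..<n} \<longrightarrow> a i \<in> {..d}) \<and> (i \<notin> {..<n} \<longrightarrow> a i = 0)}"
      by (auto simp: monomials_le_def)
  qed
qed (rule finite_set_of_finite_funs; simp)

lemma poly_deg_le_multilinear:
  "poly_deg_le n n (\<lambda>x. \<Sum>S\<in>Pow {..<n}. c S * (\<Prod>i\<in>S. x i))"
  unfolding poly_deg_le_def
proof (intro exI ext)
  define ind where "ind = (\<lambda>S (i :: nat). of_bool (i \<in> S) :: nat)"
  define c' where "c' = (\<lambda>a. if a \<in> ind ` Pow {..<n} then c {i. a i = 1} else 0)"
  fix x :: "nat \<Rightarrow> real"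
  have sub: "ind ` Pow {..<n} \<subseteq> monomials_le n n"
  proof clarify
    fix S assume S: "S \<subseteq> {..<n}"
    have "sum (ind S) {..<n} \<le> (\<Sum>i<n. 1)" by (intro sum_mono) (auto simp: ind_def)
    with S show "ind S \<in> monomials_le n n" by (auto simp: monomials_le_def ind_def)
  qed
  have inj: "inj_on ind (Pow {..<n})"
    by (rule inj_onI) (auto simp: ind_def fun_eq_iff of_bool_eq_iff)
  have "(\<Sum>a\<in>monomials_le n n. c' a * (\<Prod>i<n. x i ^ a i))
      = (\<Sum>a\<in>ind ` Pow {..<n}. c' a * (\<Prod>i<n. x i ^ a i))"
    using sub finite_monomials_le by (intro sum.mono_neutral_right) (auto simp: c'_def)
  also have "\<dots> = (\<Sum>S\<in>Pow {..<n}. c' (ind S) * (\<Prod>i<n. x i ^ ind S i))"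
    using inj by (simp add: sum.reindex)
  also have "\<dots> = (\<Sum>S\<in>Pow {..<n}. c S * (\<Prod>i\<in>S. x i))"
  proof (rule sum.cong[OF refl])
    fix S assume S: "S \<in> Pow {..<n}"
    then have "c' (ind S) = c S" by (auto simp: c'_def ind_def)
    moreover have "(\<Prod>i<n. x i ^ ind S i) = (\<Prod>i\<in>S. x i)"
      using S by (intro prod.mono_neutral_cong_right) (auto simp: ind_def)
    ultimately show "c' (ind S) * (\<Prod>i<n. x i ^ ind S i) = c S * (\<Prod>i\<in>S. x i)" by simp
  qed
  finally show "(\<Sum>S\<in>Pow {..<n}. c S * (\<Prod>i\<in>S. x i))
      = (\<Sum>a\<in>monomials_le n n. c' a * (\<Prod>i<n. x i ^ a i))" by simp
qed

text \<open>The multilinear extension represents \<open>f\<close> exactly in degree at most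
  \<open>n\<close>, so the minimum is over a nonempty set and is attained.\<close>

lemma adeg_witness:
  obtains q where "poly_deg_le n (adeg n f) q" "eps_approx n (1/3) q f"
proof -
  let ?q = "\<lambda>x. \<Sum>S\<in>Pow {..<n}. mobius_coeff f S * (\<Prod>i\<in>S. x i)"
  have "eps_approx n (1/3) ?q f"
    by (simp add: eps_approx_def sum_mobius_coeff)
  then have "\<exists>q. poly_deg_le n n q \<and> eps_approx n (1/3) q f"
    using poly_deg_le_multilinear by blast
  then have "\<exists>q. poly_deg_le n (adeg n f) q \<and> eps_approx n (1/3) q f"
    unfolding adeg_def by (rule LeastI)
  then show thesis using that by blast
qed

lemma card_support_monomial_le:
  assumes "a \<in> monomials_le n d"
  shows "finite {i. a i \<noteq> 0}" "card {i. a i \<noteq> 0} \<le> d"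
proof -
  have sub: "{i. a i \<noteq> 0} \<subseteq> {..<n}"
    using assms unfolding monomials_le_def by (auto intro: ccontr)
  then show fin: "finite {i. a i \<noteq> 0}" using finite_subset by blast
  have "card {i. a i \<noteq> 0} = (\<Sum>i\<in>{i. a i \<noteq> 0}. 1)" by simp
  also have "\<dots> \<le> (\<Sum>i\<in>{i. a i \<noteq> 0}. a i)" by (intro sum_mono) auto
  also have "\<dots> \<le> sum a {..<n}" using sub by (intro sum_mono2) auto
  also have "\<dots> \<le> d" using assms by (simp add: monomials_le_def)
  finally show "card {i. a i \<noteq> 0} \<le> d" .
qed

text \<open>Powers of 0 and 1 depend only on whether the exponent is zero. This brings
  \<open>q\<close> into the form that \<open>fourier_entry_low_degree\<close> expects.\<close>

lemma monomial_on_cube: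
  assumes "a \<in> monomials_le n d"
  shows "(\<Prod>i<n. to_real (\<lambda>i. i \<in> T) i ^ a i) = of_bool ({i. a i \<noteq> 0} \<subseteq> T)"
proof (cases "{i. a i \<noteq> 0} \<subseteq> T")
  case True
  then have "(\<Prod>i<n. to_real (\<lambda>i. i \<in> T) i ^ a i) = (\<Prod>i<n. 1)"
    by (intro prod.cong) (auto simp: to_real_def power_0_left)
  with True show ?thesis by simp
next
  case False
  then obtain i where "a i \<noteq> 0" "i \<notin> T" by blast
  moreover from this have "i < n"
    using assms unfolding monomials_le_def by (auto intro: ccontr)
  ultimately have "(\<Prod>i<n. to_real (\<lambda>i. i \<in> T) i ^ a i) = 0"
    by (intro prod_zero) (auto simp: to_real_def)
  with False show ?thesis by simp
qed

text \<open>The Moebius coefficients serve as witness. If one is nonzero at \<open>S\<close>, then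
  \<open>full_degree_bound\<close> applies on the subcube of points supported in \<open>S\<close>,
  to which \<open>q\<close> restricts without increase of degree.\<close>

lemma bdeg_le: "bdeg n f \<le> 144 * (adeg n f)\<^sup>2"
  unfolding bdeg_def
proof (rule Least_le, intro exI conjI allI impI ballI)
  fix x assume "x \<in> cube n"
  \<comment> \<open>Coefficients are cut to 0 off \<open>Pow {..<n}\<close>, since the vanishing
    condition ranges over all sets.\<close>
  have "(\<Sum>S\<in>Pow {..<n}. (if S \<subseteq> {..<n} then mobius_coeff f S else 0) * (\<Prod>i\<in>S. to_real x i))
      = (\<Sum>S\<in>Pow {..<n}. mobius_coeff f S * (\<Prod>i\<in>S. to_real x i))"
    by (intro sum.cong) auto
  also have "\<dots> = (if f x then 1 else 0)"
    using \<open>x \<in> cube n\<close> by (simp add: sum_mobius_coeff)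
  finally show "(\<Sum>S\<in>Pow {..<n}. (if S \<subseteq> {..<n} then mobius_coeff f S else 0) * (\<Prod>i\<in>S. to_real x i))
      = (if f x then 1 else 0)" .
next
  fix S :: "nat set" assume big: "144 * (adeg n f)\<^sup>2 < card S"
  obtain q where q: "poly_deg_le n (adeg n f) q" "eps_approx n (1/3) q f"
    by (rule adeg_witness)
  from q(1) obtain c where c: "q = (\<lambda>x. \<Sum>a\<in>monomials_le n (adeg n f). c a * (\<Prod>i<n. x i ^ a i))"
    unfolding poly_deg_le_def by blast
  define P where "P = (\<lambda>T. q (to_real (\<lambda>i. i \<in> T)))"
  have P: "P T = (\<Sum>a\<in>monomials_le n (adeg n f). c a * of_bool ({i. a i \<noteq> 0} \<subseteq> T))" for T
    by (simp add: P_def c monomial_on_cube)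
  have "mobius_coeff f S = 0" if S: "S \<subseteq> {..<n}"
  proof (rule ccontr)
    assume nz: "mobius_coeff f S \<noteq> 0"
    have fin: "finite S" using S finite_subset by blast
    have cube: "(\<lambda>i. i \<in> T) \<in> cube n" if "T \<subseteq> S" for T
      using that S by (auto simp: cube_def)
    have "card S \<le> 144 * (adeg n f)\<^sup>2"
    proof (rule full_degree_bound[OF fin, where F = "\<lambda>T. f (\<lambda>i. i \<in> T)" and P = P])
      show "(\<Sum>T\<in>Pow S. (-1) ^ card T * of_bool (f (\<lambda>i. i \<in> T))) \<noteq> (0 :: real)"
        using nz by (auto simp: mobius_coeff_def)
      show "fourier_entry S P U V = 0"
        if "U \<subseteq> S" "V \<subseteq> S" "card U + adeg n f < card V" for U V
        using fin that P by (rule fourier_entry_low_degree) (intro conjI card_support_monomial_le)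
    qed (use q(2) cube in \<open>auto simp: eps_approx_def P_def\<close>)
    with big show False by simp
  qed
  then show "(if S \<subseteq> {..<n} then mobius_coeff f S else 0) = 0" by simp
qed

theorem theorem1p4:
  shows "\<exists>C :: real. \<forall>(n :: nat) (f :: (nat \<Rightarrow> bool) \<Rightarrow> bool).
           real (bdeg n f) \<le> C * real (adeg n f) ^ 2"
proof (intro exI allI)
  fix n f
  have "real (bdeg n f) \<le> real (144 * (adeg n f)\<^sup>2)"
    using bdeg_le by (simp only: of_nat_le_iff)
  then show "real (bdeg n f) \<le> 144 * real (adeg n f) ^ 2" by simp
qed

end
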